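(* For any countable ordinal $\gamma$, there exist Borel functions $f,g \colon 2^{\mathbb{N}} \rightarrow \{0,1\}$ such that $f^{-1}(\{1\})$ is open, the set $g^{-1}(\{1\})$ is $\boldsymbol{\Sigma}^0_\gamma$-hard or $\boldsymbol{\Pi}^0_\gamma$-hard, and for any restriction $\rho$ such that $f^\rho$ is constant, the function $g^\rho$ is also constant.
   Context: $2^{\mathbb{N}}$ has the product topology. A set $S\subseteq 2^{\mathbb{N}}$ is $\boldsymbol{\Sigma}^0_0$ (equivalently $\boldsymbol{\Pi}^0_0$) if it is clopen. For $1\le\alpha<\omega_1$, a set is $\boldsymbol{\Sigma}^0_\alpha$ (resp. $\boldsymbol{\Pi}^0_\alpha$) if it is a countable union (resp. intersection) of sets $S_n$, $n\in\mathbb{N}$, each of which is $\boldsymbol{\Pi}^0_{\beta_n}$ (resp. $\boldsymbol{\Sigma}^0_{\beta_n}$) for some $\beta_n<\alpha$ (for $\alpha\geq 1$ this is the usual Borel hierarchy). For a class $\mathcal{C}\subseteq\mathcal{P}(2^{\mathbb{N}})$, a set $S\subseteq 2^{\mathbb{N}}$ is $\mathcal{C}$-hard if for every $S'\in\mathcal{C}$ there is a continuous map $\varphi\colon 2^{\mathbb{N}}\to 2^{\mathbb{N}}$ with $x\in S'\iff\varphi(x)\in S$. A restriction is a function $\rho\colon\mathbb{N}\to\{0,1,*\}$. For a function $f$ on $2^{\mathbb{N}}$, the restricted function $f^\rho$ has domain $2^{\rho^{-1}(\{*\})}$: given values for the variables $x_i$ with $\rho(i)=*$, it evaluates $f$ on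 the input obtained by setting every other $x_i$ to $\rho(i)$. *)

theory Defs
  imports "HOL-Analysis.Analysis"
begin

unbundle cardinal_syntax

(* The topology of this type in HOL-Analysis is the product of the discrete topologies on bool. *)
type_synonym cantor = "nat \<Rightarrow> bool"

(* A countable ordinal is represented by a well-order on some subset of the natural numbers
   (finite or infinite); {} represents 0. The strict order of ordinals is <o, and by Sigma0_ordIso
   and Pi0_ordIso below the classes depend only on the order type. *)
inductive Sigma0 :: "nat rel \<Rightarrow> cantor set \<Rightarrow> bool"
  and Pi0 :: "nat rel \<Rightarrow> cantor set \<Rightarrow> bool" where
  Sigma0_zero: "open S \<Longrightarrow> closed S \<Longrightarrow> Sigma0 {} S"
| Pi0_zero: "open S \<Longrightarrow> closed S \<Longrightarrow> Pi0 {} S"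
| Sigma0_Union: "(\<And>n::nat. \<beta> n <o \<alpha> \<and> Pi0 (\<beta> n) (S n)) \<Longrightarrow> Sigma0 \<alpha> (\<Union>n. S n)"
| Pi0_Inter: "(\<And>n::nat. \<beta> n <o \<alpha> \<and> Sigma0 (\<beta> n) (S n)) \<Longrightarrow> Pi0 \<alpha> (\<Inter>n. S n)"

lemma ordIso_empty: "({} :: nat rel, \<alpha>) \<in> ordIso \<Longrightarrow> \<alpha> = {}"
  unfolding ordIso_def iso_def bij_betw_def Field_def by auto

lemma Sigma0_ordIso: "Sigma0 \<alpha> S \<Longrightarrow> (\<alpha>, \<alpha>') \<in> ordIso \<Longrightarrow> Sigma0 \<alpha>' S"
  by (erule Sigma0.cases)
     (use ordIso_empty Sigma0_zero in blast, metis Sigma0_Union ordLess_ordIso_trans)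

lemma Pi0_ordIso: "Pi0 \<alpha> S \<Longrightarrow> (\<alpha>, \<alpha>') \<in> ordIso \<Longrightarrow> Pi0 \<alpha>' S"
  by (erule Pi0.cases)
     (use ordIso_empty Pi0_zero in blast, metis Pi0_Inter ordLess_ordIso_trans)

definition hard_for :: "cantor set set \<Rightarrow> cantor set \<Rightarrow> bool" where
  "hard_for C S \<longleftrightarrow>
     (\<forall>S'\<in>C. \<exists>\<phi> :: cantor \<Rightarrow> cantor. continuous_on UNIV \<phi> \<and> (\<forall>x. x \<in> S' \<longleftrightarrow> \<phi> x \<in> S))"

(* None stands for the star. *)
type_synonym restriction = "nat \<Rightarrow> bool option"

definition stars :: "restriction \<Rightarrow> nat set" where
  "stars \<rho> = \<rho> -` {None}"

(* The restricted function has domain 2^(stars rho), i.e. the extensional functions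
   stars rho \<rightarrow>\<^sub>E UNIV; the values of y outside stars rho are never read. *)
definition restricted :: "(cantor \<Rightarrow> 'b) \<Rightarrow> restriction \<Rightarrow> cantor \<Rightarrow> 'b" where
  "restricted f \<rho> y = f (\<lambda>i. case \<rho> i of None \<Rightarrow> y i | Some b \<Rightarrow> b)"

definition restricted_constant :: "(cantor \<Rightarrow> 'b) \<Rightarrow> restriction \<Rightarrow> bool" where
  "restricted_constant f \<rho> \<longleftrightarrow> restricted f \<rho> constant_on (stars \<rho> \<rightarrow>\<^sub>E UNIV)"

end

theory Submission
  imports Defs
begin

text \<open>
  Take for \<open>f\<close> the predicate \<open>mismatch\<close>, which tests whether a point violates one of the equations
  \<open>x (2 * i) = x (2 * i + 1)\<close>. The closed set \<open>f -` {False}\<close> is then a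
  homeomorphic copy of the whole Cantor space inside itself (every bit is written twice), yet it
  contains no two points that differ in a single coordinate. So a restriction on which \<open>f\<close> is
  constantly \<open>False\<close> leaves no variable free, and \<open>g\<close> may be chosen
  arbitrarily complicated on this copy without being seen by such restrictions; declaring \<open>g\<close>
  to be \<open>False\<close> wherever \<open>f\<close> is \<open>True\<close> settles the
  other restrictions (\<open>restricted_constant_transfer\<close>).

  It remains to put a hard Borel set on the copy. As in the construction of universal sets, such a
  set arises by well-founded induction on the ordinal (\<open>borel_Sigma0_hard\<close>): a point is read as
  a sequence of rows together with a table that assigns to each row one of the countably many
  smaller ordinals, and it is accepted if some row lies outside the hard set of its ordinal.
\<close>

section \<open>Continuity and reductions\<close>

lemma vimage_bool:
  "f -` B = (if True \<in> B then {x. f x} else {}) \<union> (if False \<in> B then - {x. f x} else {})"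
proof (rule set_eqI)
  fix x
  show "x \<in> f -` B \<longleftrightarrow>
      x \<in> (if True \<in> B then {x. f x} else {}) \<union> (if False \<in> B then - {x. f x} else {})"
    by (cases "f x") simp_all
qed

lemma continuous_clopen_membership:
  fixes S :: "'a::topological_space set"
  assumes "open S" "closed S"
  shows "continuous_on UNIV (\<lambda>x. x \<in> S)"
  using assms
  by (simp add: continuous_on_open_vimage vimage_bool[of "\<lambda>x. x \<in> S"] open_Un open_Compl)

lemma continuous_reindex: "continuous_on UNIV (\<lambda>(x::cantor) i. x (h i))"
  by (intro continuous_on_coordinatewise_then_product continuous_on_product_coordinates)

lemma open_coordinate: "open {x::cantor. x i}"
proof -
  have "open ((\<lambda>x::cantor. x i) -` {True})"
    by (intro open_vimage open_discrete continuous_on_product_coordinates)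
  then show ?thesis by (simp add: vimage_def)
qed

lemma borel_reindex_vimage:
  assumes "A \<in> sets borel"
  shows "{x::cantor. (\<lambda>i. x (h i)) \<in> A} \<in> sets borel"
  using measurable_sets[OF borel_measurable_continuous_onI[OF continuous_reindex] assms]
  by (simp add: vimage_def)

lemma borel_measurable_bool:
  fixes f :: "'a::topological_space \<Rightarrow> bool"
  assumes "{x. f x} \<in> sets borel"
  shows "f \<in> borel_measurable borel"
proof (rule borel_measurableI)
  fix B :: "bool set"
  show "f -` B \<inter> space borel \<in> sets borel"
    unfolding vimage_bool[of f] using assms by (simp add: borel_comp sets.Un)
qed

lemma hard_for_reduction:
  fixes r :: "cantor \<Rightarrow> cantor"
  assumes "hard_for C A" "continuous_on UNIV r" "\<And>x. r x \<in> B \<longleftrightarrow> x \<in> A"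
  shows "hard_for C B"
  unfolding hard_for_def
proof
  fix S assume "S \<in> C"
  then obtain \<phi> :: "cantor \<Rightarrow> cantor"
    where "continuous_on UNIV \<phi>" "\<And>x. x \<in> S \<longleftrightarrow> \<phi> x \<in> A"
    using assms(1) unfolding hard_for_def by blast
  then show "\<exists>\<phi>::cantor \<Rightarrow> cantor. continuous_on UNIV \<phi> \<and> (\<forall>x. x \<in> S \<longleftrightarrow> \<phi> x \<in> B)"
    using assms(3) continuous_on_compose2[OF assms(2), of UNIV \<phi>]
    by (intro exI[of _ "\<lambda>x. r (\<phi> x)"]) auto
qed

section \<open>Borel sets that are hard for a level of the hierarchy\<close>

lemma Sigma0_Pi0_Compl:
  "Sigma0 \<alpha> S \<Longrightarrow> Pi0 \<alpha> (- S)"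
  "Pi0 \<alpha> S \<Longrightarrow> Sigma0 \<alpha> (- S)"
proof (induction rule: Sigma0_Pi0.inducts)
  case (Sigma0_Union \<beta> \<alpha> S)
  then show ?case
    by (simp add: Compl_UN Pi0_Inter[where \<beta> = \<beta>])
next
  case (Pi0_Inter \<beta> \<alpha> S)
  then show ?case
    by (simp add: Compl_INT Sigma0_Union[where \<beta> = \<beta>])
qed (auto intro: Sigma0_zero Pi0_zero)

text \<open>
  Every ordinal below \<open>\<alpha>\<close> is the order type of a proper initial segment of \<open>\<alpha>\<close>, and the
  segments are indexed by natural numbers. This is what makes the table of ordinals in the
  construction of a hard set a countable object.
\<close>

definition segment :: "nat rel \<Rightarrow> nat \<Rightarrow> nat rel" where
  "segment \<alpha> k = Restr \<alpha> (underS \<alpha> k)"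

lemma ordLess_imp_segment:
  assumes "\<beta> <o \<alpha>"
  obtains k where "segment \<alpha> k <o \<alpha>" "(\<beta>, segment \<alpha> k) \<in> ordIso" "k \<in> Field \<alpha>"
proof -
  have wo: "Well_order \<beta>" "Well_order \<alpha>"
    using assms by (auto simp: ordLess_def)
  then obtain k where k: "k \<in> Field \<alpha>" "(\<beta>, segment \<alpha> k) \<in> ordIso"
    using assms ordLess_iff_ordIso_Restr[of \<alpha> \<beta>] by (auto simp: segment_def)
  moreover have "segment \<alpha> k <o \<alpha>"
    using k assms ordIso_ordLess_trans ordIso_symmetric by blast
  ultimately show thesis using that by blast
qed

text \<open>
  Row \<open>0\<close> of \<open>x\<close> is the table: its entry at \<open>(n, k)\<close> says that row \<open>n + 1\<close> is
  to be tested against \<open>A k\<close>. Tables that are not the graph of a function of \<open>n\<close> are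
  harmless, since reductions need not produce them.
\<close>

definition row_union :: "(nat \<Rightarrow> cantor set) \<Rightarrow> cantor set" where
  "row_union A = {x. \<exists>n k. x (prod_encode (0, prod_encode (n, k))) \<and>
                         (\<lambda>i. x (prod_encode (Suc n, i))) \<notin> A k}"

lemma borel_row_union:
  assumes "\<And>k. A k \<in> sets borel"
  shows "row_union A \<in> sets borel"
proof -
  have "row_union A = (\<Union>n k. {x. x (prod_encode (0, prod_encode (n, k)))} \<inter>
                             {x. (\<lambda>i. x (prod_encode (Suc n, i))) \<in> - A k})"
    by (auto simp: row_union_def)
  also have "\<dots> \<in> sets borel"
    by (intro sets.countable_UN image_subsetI sets.Int borel_open[OF open_coordinate]
        borel_reindex_vimage borel_comp assms)
  finally show ?thesis .
qed

text \<open>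
  The reduction writes the graph of \<open>k\<close> into the table, which is a constant, and the value of
  \<open>\<phi> n\<close> into row \<open>n + 1\<close>; each coordinate therefore depends on at most one \<open>\<phi> n\<close>.
\<close>

lemma row_union_reduction:
  fixes \<phi> :: "nat \<Rightarrow> cantor \<Rightarrow> cantor"
  assumes "\<And>n. continuous_on UNIV (\<phi> n)"
    and red: "\<And>n x. x \<in> S n \<longleftrightarrow> \<phi> n x \<notin> A (k n)"
  shows "\<exists>\<psi>::cantor \<Rightarrow> cantor. continuous_on UNIV \<psi> \<and> (\<forall>x. x \<in> (\<Union>n. S n) \<longleftrightarrow> \<psi> x \<in> row_union A)"
proof -
  define \<psi> :: "cantor \<Rightarrow> cantor" where
    "\<psi> x j = (case prod_decode j of
        (0, i) \<Rightarrow> snd (prod_decode i) = k (fst (prod_decode i))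
      | (Suc n, i) \<Rightarrow> \<phi> n x i)" for x j
  have "continuous_on UNIV \<psi>"
  proof (rule continuous_on_coordinatewise_then_product)
    fix j
    obtain m i where j: "prod_decode j = (m, i)" by fastforce
    show "continuous_on UNIV (\<lambda>x. \<psi> x j)"
    proof (cases m)
      case 0
      then show ?thesis by (simp add: \<psi>_def j)
    next
      case (Suc n)
      then show ?thesis
        using continuous_on_product_then_coordinatewise[OF assms(1)] by (simp add: \<psi>_def j)
    qed
  qed
  moreover have "x \<in> (\<Union>n. S n) \<longleftrightarrow> \<psi> x \<in> row_union A" for x
    by (auto simp: row_union_def \<psi>_def red)
  ultimately show ?thesis by blast
qed

text \<open>
  A set in \<open>Sigma0 \<alpha>\<close> is a union of sets whose complements are in \<open>Sigma0\<close> of initial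
  segments of \<open>\<alpha>\<close>, so hard sets for all segments combine to one for \<open>\<alpha>\<close>. At the
  bottom, any set that is neither empty nor everything is hard for the clopen sets.
\<close>

lemma borel_Sigma0_hard:
  fixes \<alpha> :: "nat rel"
  shows "\<exists>A \<in> sets borel. hard_for (Collect (Sigma0 \<alpha>)) A"
proof (induction \<alpha> rule: wf_induct_rule[OF wf_ordLess])
  case (1 \<alpha>)
  show ?case
  proof (cases "\<alpha> = {}")
    case True
    have no_less: "\<not> \<beta> <o \<alpha>" for \<beta> :: "nat rel"
      using True by (metis Field_empty empty_iff ordLess_imp_segment)
    have "hard_for (Collect (Sigma0 \<alpha>)) {x. x 0}"
      unfolding hard_for_def
    proof clarify
      fix S assume "Sigma0 \<alpha> S"
      then have "open S \<and> closed S"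
        using no_less by cases auto
      then have "open S" "closed S" by simp_all
      then show "\<exists>\<phi>::cantor \<Rightarrow> cantor. continuous_on UNIV \<phi> \<and> (\<forall>x. x \<in> S \<longleftrightarrow> \<phi> x \<in> {x. x 0})"
        by (intro exI[of _ "\<lambda>x i. x \<in> S"])
          (auto intro: continuous_on_coordinatewise_then_product continuous_clopen_membership)
    qed
    then show ?thesis
      using borel_open[OF open_coordinate] by blast
  next
    case False
    have "\<forall>k. \<exists>A. A \<in> sets borel \<and>
        (segment \<alpha> k <o \<alpha> \<longrightarrow> hard_for (Collect (Sigma0 (segment \<alpha> k))) A)"
      using "1.IH" sets.empty_sets by blast
    then obtain A where A: "\<And>k. A k \<in> sets borel"
      and hard: "\<And>k. segment \<alpha> k <o \<alpha> \<Longrightarrow> hard_for (Collect (Sigma0 (segment \<alpha> k))) (A k)"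
      by metis
    have "hard_for (Collect (Sigma0 \<alpha>)) (row_union A)"
      unfolding hard_for_def
    proof clarify
      fix S assume "Sigma0 \<alpha> S"
      then obtain \<beta> T where S: "S = (\<Union>n::nat. T n)"
        and T: "\<And>n. \<beta> n <o \<alpha>" "\<And>n. Pi0 (\<beta> n) (T n)"
        using False by cases auto
      have "\<exists>k \<phi>. continuous_on UNIV \<phi> \<and> (\<forall>x. x \<in> T n \<longleftrightarrow> \<phi> x \<notin> A k)" for n
      proof -
        obtain k where k: "segment \<alpha> k <o \<alpha>" "(\<beta> n, segment \<alpha> k) \<in> ordIso"
          using ordLess_imp_segment[OF T(1)] by blast
        have "Sigma0 (segment \<alpha> k) (- T n)"
          using Sigma0_Pi0_Compl(2)[OF T(2)] k(2) by (rule Sigma0_ordIso)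
        then obtain \<phi> :: "cantor \<Rightarrow> cantor"
          where "continuous_on UNIV \<phi>" "\<forall>x. x \<in> - T n \<longleftrightarrow> \<phi> x \<in> A k"
          using hard[OF k(1)] unfolding hard_for_def by blast
        then show ?thesis by blast
      qed
      then obtain k \<phi> where "\<And>n. continuous_on UNIV (\<phi> n)"
        "\<And>n x. x \<in> T n \<longleftrightarrow> \<phi> n x \<notin> A (k n)"
        by metis
      then show "\<exists>\<psi>::cantor \<Rightarrow> cantor. continuous_on UNIV \<psi> \<and> (\<forall>x. x \<in> S \<longleftrightarrow> \<psi> x \<in> row_union A)"
        unfolding S by (rule row_union_reduction)
    qed
    then show ?thesis
      using borel_row_union[of A, OF A] by blast
  qed
qed

section \<open>Doubling every bit\<close>

definition mismatch :: "cantor \<Rightarrow> bool" where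
  "mismatch x \<longleftrightarrow> (\<exists>i. x (2 * i) \<noteq> x (2 * i + 1))"

lemma open_mismatch: "open {x. mismatch x}"
proof -
  have "{x. mismatch x} = (\<Union>i. {x. x (2 * i) \<noteq> x (2 * i + 1)})"
    by (auto simp: mismatch_def)
  also have "open \<dots>"
    by (intro open_UN ballI open_Collect_neq continuous_on_product_coordinates)
  finally show ?thesis .
qed

lemma mismatch_flip:
  assumes "\<not> mismatch x"
  shows "mismatch (x(j := \<not> x j))"
proof (cases "even j")
  case True
  then obtain i where "j = 2 * i" by blast
  then show ?thesis using assms by (auto simp: mismatch_def intro!: exI[of _ i])
next
  case False
  then obtain i where "j = 2 * i + 1" by (blast elim: oddE)
  then show ?thesis using assms by (auto simp: mismatch_def intro!: exI[of _ i])
qed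

text \<open>
  A free variable of \<open>\<rho>\<close> can be flipped inside the subcube of \<open>\<rho>\<close>, so if \<open>f\<close>
  vanishes on the subcube and detects flips of its zeros, the subcube is a single point.
\<close>

lemma restricted_constant_transfer:
  fixes f g :: "cantor \<Rightarrow> bool"
  assumes const: "restricted_constant f \<rho>"
    and flip: "\<And>x j. \<not> f x \<Longrightarrow> f (x(j := \<not> x j))"
    and g: "\<And>x. f x \<Longrightarrow> \<not> g x"
  shows "restricted_constant g \<rho>"
proof -
  obtain c where c: "\<And>y. y \<in> stars \<rho> \<rightarrow>\<^sub>E UNIV \<Longrightarrow> restricted f \<rho> y = c"
    using const by (auto simp: restricted_constant_def constant_on_def)
  show ?thesis
  proof (cases c)
    case True
    then have "restricted g \<rho> y = False" if "y \<in> stars \<rho> \<rightarrow>\<^sub>E UNIV" for y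
      using c[OF that] g by (simp add: restricted_def)
    then show ?thesis
      by (auto simp: restricted_constant_def constant_on_def)
  next
    case False
    have "stars \<rho> = {}"
    proof (rule ccontr)
      assume "stars \<rho> \<noteq> {}"
      then obtain j where j: "j \<in> stars \<rho>" by blast
      define y :: cantor where "y = restrict (\<lambda>_. False) (stars \<rho>)"
      define x where "x = (\<lambda>i. case \<rho> i of None \<Rightarrow> y i | Some b \<Rightarrow> b)"
      have y: "y \<in> stars \<rho> \<rightarrow>\<^sub>E UNIV" "y(j := \<not> y j) \<in> stars \<rho> \<rightarrow>\<^sub>E UNIV"
        using j by (auto simp: y_def PiE_def extensional_def)
      have "(\<lambda>i. case \<rho> i of None \<Rightarrow> (y(j := \<not> y j)) i | Some b \<Rightarrow> b) = x(j := \<not> x j)"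
        using j by (auto simp: x_def stars_def fun_eq_iff split: option.split)
      then have "\<not> f x" "\<not> f (x(j := \<not> x j))"
        using c[OF y(1)] c[OF y(2)] False by (simp_all add: restricted_def x_def)
      then show False using flip by blast
    qed
    then show ?thesis
      by (simp add: restricted_constant_def constant_on_def)
  qed
qed

theorem theorem5p4:
  fixes \<gamma> :: "nat rel"
  assumes "Well_order \<gamma>"
  shows "\<exists>f g :: cantor \<Rightarrow> bool.
    f \<in> borel_measurable borel \<and> g \<in> borel_measurable borel \<and>
    open (f -` {True}) \<and>
    (hard_for (Collect (Sigma0 \<gamma>)) (g -` {True}) \<or> hard_for (Collect (Pi0 \<gamma>)) (g -` {True})) \<and>
    (\<forall>\<rho>. restricted_constant f \<rho> \<longrightarrow> restricted_constant g \<rho>)"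
proof -
  obtain A where A: "A \<in> sets borel" "hard_for (Collect (Sigma0 \<gamma>)) A"
    using borel_Sigma0_hard by blast
  define g where "g x \<longleftrightarrow> \<not> mismatch x \<and> (\<lambda>i. x (2 * i)) \<in> A" for x
  have "{x. g x} = - {x. mismatch x} \<inter> {x. (\<lambda>i. x (2 * i)) \<in> A}"
    by (auto simp: g_def)
  also have "\<dots> \<in> sets borel"
    by (intro sets.Int borel_comp borel_open open_mismatch borel_reindex_vimage A)
  finally have "g \<in> borel_measurable borel"
    by (rule borel_measurable_bool)
  moreover have "mismatch \<in> borel_measurable borel"
    by (intro borel_measurable_bool borel_open open_mismatch)
  moreover have "open (mismatch -` {True})"
    using open_mismatch by (simp add: vimage_def)
  moreover have "hard_for (Collect (Sigma0 \<gamma>)) (g -` {True})"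
    using A(2) continuous_reindex[of "\<lambda>i. i div 2"]
    by (rule hard_for_reduction) (simp add: g_def mismatch_def)
  moreover have "restricted_constant g \<rho>" if "restricted_constant mismatch \<rho>" for \<rho>
    by (rule restricted_constant_transfer[OF that mismatch_flip]) (simp_all add: g_def)
  ultimately show ?thesis by blast
qed

end
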